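(* Let $n\ge1$. Under the model $LC_n$, with the curator receiving $n$ samples, there is an adaptive analyst strategy which causes the posterior mean curator strategy to answer $\frac14$-inaccurately (on at least one query) with probability $>\frac12$, using only $n+2$ queries.
   Context: Bayesian adaptive data analysis. A model consists of a universe $\mathcal X$ and a prior $\mathcal P$ over probability distributions on $\mathcal X$ (hypotheses), both known to the two players, curator and analyst. A distribution $\vec p$ is drawn from $\mathcal P$, unknown to both. The curator receives $n$ independent samples from $\vec p$. The analyst then asks queries $f:\mathcal X\to[0,1]$ one at a time, each possibly depending on previous answers (adaptive strategy); the curator replies to each with $a\in\mathbb R$. The answer is $\epsilon$-accurate if $|\mathbb E_{x\sim\vec p}f(x)-a|<\epsilon$, and $\epsilon$-inaccurate otherwise. Probabilities are over $\vec p$, the samples and any randomness of the players. Players are computationally unbounded. Posterior mean curator: for each query $f$ he answers $\mathbb E_{\vec p\sim\mathcal P'}\mathbb E_{x\sim\vec p}[f(x)]$, where $\mathcal P'$ is the posterior obtained from $\mathcal P$ by Bayes' rule given the $n$ samples. Linear classification model $LC_m$: universe $\mathbb F_2^m\times\mathbb F_2$; coefficients $a,b_1,\dots,b_m\in\mathbb F_2$ are chosen independently and uniformly, and the hypothesis is the uniform distribution on the graph $\{(y,\ell(y)):y\in\mathbb F_2^m\}$ of $\ell(x_1,\dots,x_m)=a+\sum_k b_kx_k$. *)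

theory Defs
  imports "HOL-Analysis.Analysis" "HOL-Probability.Probability" "HOL-Library.Z2"
begin

section \<open>Bayesian adaptive data analysis\<close>

type_synonym 'a query = "'a \<Rightarrow> real"

text \<open>Queries asked so far together with the curator's answers, oldest first.\<close>
type_synonym 'a history = "('a query \<times> real) list"

text \<open>A strategy picks its next move at random given everything the player has seen: the analyst
  sees the history but not the samples; the curator sees the samples, the history and the
  current query. A point mass is a deterministic move.\<close>
type_synonym 'a analyst = "'a history \<Rightarrow> 'a query pmf"
type_synonym 'a curator = "'a list \<Rightarrow> 'a history \<Rightarrow> 'a query \<Rightarrow> real pmf"

definition valid_query :: "'a query \<Rightarrow> bool" where
  "valid_query f \<longleftrightarrow> (\<forall>x. 0 \<le> f x \<and> f x \<le> 1)"

definition valid_analyst :: "'a analyst \<Rightarrow> bool" where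
  "valid_analyst A \<longleftrightarrow> (\<forall>h. \<forall>f \<in> set_pmf (A h). valid_query f)"

definition accurate :: "real \<Rightarrow> 'a pmf \<Rightarrow> 'a query \<Rightarrow> real \<Rightarrow> bool" where
  "accurate \<epsilon> p f a \<longleftrightarrow> \<bar>measure_pmf.expectation p f - a\<bar> < \<epsilon>"

text \<open>Joint distribution of the hypothesis and \<open>n\<close> independent samples from it.\<close>
definition hyp_samples :: "'a pmf pmf \<Rightarrow> nat \<Rightarrow> ('a pmf \<times> 'a list) pmf" where
  "hyp_samples P n = bind_pmf P (\<lambda>p. map_pmf (\<lambda>s. (p, s)) (replicate_pmf n p))"

primrec transcript :: "'a curator \<Rightarrow> 'a analyst \<Rightarrow> 'a list \<Rightarrow> nat \<Rightarrow> 'a history pmf" where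
  "transcript C A s 0 = return_pmf []"
| "transcript C A s (Suc k) =
     bind_pmf (transcript C A s k) (\<lambda>h.
     bind_pmf (A h) (\<lambda>f.
     map_pmf (\<lambda>a. h @ [(f, a)]) (C s h f)))"

text \<open>Joint distribution of the hypothesis and the transcript of \<open>k\<close> queries, when the curator
  receives \<open>n\<close> samples.\<close>
definition game :: "'a pmf pmf \<Rightarrow> nat \<Rightarrow> 'a curator \<Rightarrow> 'a analyst \<Rightarrow> nat \<Rightarrow> ('a pmf \<times> 'a history) pmf" where
  "game P n C A k =
     bind_pmf (hyp_samples P n) (\<lambda>(p, s). map_pmf (\<lambda>h. (p, h)) (transcript C A s k))"

definition some_inaccurate :: "real \<Rightarrow> ('a pmf \<times> 'a history) set" where
  "some_inaccurate \<epsilon> = {(p, h). \<exists>(f, a) \<in> set h. \<not> accurate \<epsilon> p f a}"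

text \<open>The conditional law of the hypothesis given that the sample list equals \<open>s\<close>. \<open>cond_pmf\<close> is
  only meaningful when \<open>s\<close> has positive probability, which holds for all \<open>s\<close> arising in \<open>game\<close>
  with \<open>n = length s\<close>.\<close>
definition posterior :: "'a pmf pmf \<Rightarrow> 'a list \<Rightarrow> 'a pmf pmf" where
  "posterior P s = map_pmf fst (cond_pmf (hyp_samples P (length s)) {(p, s'). s' = s})"

definition posterior_mean_curator :: "'a pmf pmf \<Rightarrow> 'a curator" where
  "posterior_mean_curator P s h f = return_pmf
     (measure_pmf.expectation (posterior P s) (\<lambda>p. measure_pmf.expectation p f))"


section \<open>The linear classification model\<close>

instance bit :: finite
proof
  have "(UNIV :: bit set) \<subseteq> {0, 1}"
    by auto
  then show "finite (UNIV :: bit set)"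
    by (rule finite_subset) simp
qed

definition affine_form :: "bit \<Rightarrow> ('m::finite \<Rightarrow> bit) \<Rightarrow> bit ^ 'm \<Rightarrow> bit" where
  "affine_form a b y = a + (\<Sum>k\<in>UNIV. b k * y $ k)"

definition graph_hyp :: "(bit ^ 'm::finite \<Rightarrow> bit) \<Rightarrow> ((bit ^ 'm) \<times> bit) pmf" where
  "graph_hyp l = pmf_of_set {(y, l y) | y. True}"

text \<open>The prior of \<open>LC\<^sub>m\<close>, where \<open>m = CARD('m)\<close>. The second argument of \<open>Pi_pmf\<close> is the value
  outside the index set, hence irrelevant here.\<close>
definition LC :: "((bit ^ 'm::finite) \<times> bit) pmf pmf" where
  "LC = map_pmf (\<lambda>(a, b). graph_hyp (affine_form a b))
     (pair_pmf (pmf_of_set UNIV) (Pi_pmf UNIV 0 (\<lambda>_. pmf_of_set UNIV)))"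

end

(*
  The posterior after the samples s is uniform on the set V of affine forms agreeing with s, and the
  curator's answers are exact reals. Hence one query with generic weights w(y) on the points (y, 1)
  already reveals V. If the n samples are affinely independent, V = {l0, l1}, and the query
  "z = l0 y and l0 y \<noteq> l1 y" has mean 1/2 under l0 and 0 under l1, so that the answer 1/4 is off
  by exactly 1/4 whichever hypothesis is true. Affine independence has probability above 1/2: the
  forms vanishing on the samples are a group W with |W| \<ge> 2, so |W| \<noteq> 2 implies |W| \<ge> 4, while
  the expectation of |W| is 3 - 2 / 2^n < 3.
*)
theory Submission
  imports Defs
begin

section \<open>Uniform distributions\<close>

lemma pair_pmf_of_set:
  assumes "finite A" "A \<noteq> {}" "finite B" "B \<noteq> {}"
  shows "pair_pmf (pmf_of_set A) (pmf_of_set B) = pmf_of_set (A \<times> B)"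
proof (rule pmf_eqI)
  fix x :: "'a \<times> 'b"
  show "pmf (pair_pmf (pmf_of_set A) (pmf_of_set B)) x = pmf (pmf_of_set (A \<times> B)) x"
    using assms by (cases x) (simp add: pmf_pair card_cartesian_product indicator_times)
qed

lemma cond_pmf_of_set:
  assumes "finite A" "A \<inter> B \<noteq> {}"
  shows "cond_pmf (pmf_of_set A) B = pmf_of_set (A \<inter> B)"
proof (rule pmf_eqI)
  fix x
  have "A \<noteq> {}" "card A \<noteq> 0" "finite (A \<inter> B)" using assms by auto
  then show "pmf (cond_pmf (pmf_of_set A) B) x = pmf (pmf_of_set (A \<inter> B)) x"
    using assms by (simp add: pmf_cond measure_pmf_of_set indicator_def)
qed

lemma replicate_pmf_map_pmf:
  "replicate_pmf n (map_pmf f p) = map_pmf (map f) (replicate_pmf n p)"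
  by (induction n)
    (simp_all add: map_pmf_def bind_assoc_pmf bind_return_pmf)

lemma finite_lists_length: "finite {xs :: 'a::finite list. length xs = n}"
  using finite_lists_length_eq[of "UNIV :: 'a set" n] by simp

lemma lists_length_nonempty: "{xs :: 'a list. length xs = n} \<noteq> {}"
  using Ex_list_of_length by blast

lemma replicate_pmf_of_set_UNIV:
  "replicate_pmf n (pmf_of_set (UNIV :: 'a::finite set)) = pmf_of_set {xs. length xs = n}"
proof (induction n)
  case 0
  then show ?case by (simp add: pmf_of_set_singleton)
next
  case (Suc n)
  let ?L = "{xs :: 'a list. length xs = n}" and ?cons = "\<lambda>(x :: 'a, xs). x # xs"
  have "replicate_pmf (Suc n) (pmf_of_set (UNIV :: 'a set)) =
      map_pmf ?cons (pair_pmf (pmf_of_set UNIV) (pmf_of_set ?L))"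
    by (simp add: Suc pair_pmf_def map_pmf_def bind_assoc_pmf bind_return_pmf)
  also have "\<dots> = pmf_of_set (?cons ` (UNIV \<times> ?L))"
    using lists_length_nonempty[of n]
    by (subst pair_pmf_of_set)
      (auto intro!: map_pmf_of_set_inj finite_cartesian_product simp: finite_lists_length inj_on_def)
  also have "?cons ` (UNIV \<times> ?L) = {xs. length xs = Suc n}"
    by (auto simp: length_Suc_conv)
  finally show ?case .
qed


section \<open>Affine forms\<close>

text \<open>These simp rules would turn sums and products of bits into \<open>of_bool\<close> terms, out of reach of
  the ring lemmas.\<close>
declare add_bit_eq_xor [simp del] mult_bit_eq_and [simp del]

lemma UNIV_bit: "(UNIV :: bit set) = {0, 1}"
  by auto

lemma card_UNIV_bit [simp]: "CARD(bit) = 2"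
  unfolding UNIV_bit by simp

lemma bit_add_eq_0_iff: "a + b = 0 \<longleftrightarrow> a = b" for a b :: bit
  by (cases a; cases b) simp_all

lemma bit_add_self: "a + a = 0" for a :: bit
  by (cases a) simp_all

definition affine_forms :: "(bit ^ 'm::finite \<Rightarrow> bit) set" where
  "affine_forms = range (\<lambda>(a, b). affine_form a b)"

lemma affine_form_axis: "affine_form a b (axis k 1) = a + b k"
  by (simp add: affine_form_def axis_def if_distrib cong: if_cong)

lemma affine_form_0: "affine_form a b 0 = a"
  by (simp add: affine_form_def)

text \<open>The value at \<open>0\<close> recovers the constant term, and the values at the unit
  vectors then recover the linear coefficients. So uniform coefficients give a uniform form.\<close>

lemma inj_affine_form: "inj (\<lambda>(a, b :: 'm::finite \<Rightarrow> bit). affine_form a b)"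
proof (rule injI, clarify)
  fix a a' and b b' :: "'m \<Rightarrow> bit"
  assume eq: "affine_form a b = affine_form a' b'"
  have a: "a = a'" using fun_cong[OF eq, of 0] by (simp add: affine_form_0)
  have "b k = b' k" for k
    using fun_cong[OF eq, of "axis k 1"] a
    by (cases "b k"; cases "b' k"; cases a') (simp_all add: affine_form_axis)
  with a show "a = a' \<and> b = b'" by auto
qed

lemma card_affine_forms:
  "card (affine_forms :: (bit ^ 'm::finite \<Rightarrow> bit) set) = 2 * 2 ^ CARD('m)"
proof -
  have "CARD(bit \<times> ('m \<Rightarrow> bit)) = 2 * 2 ^ CARD('m)"
    by (simp add: card_fun card_prod)
  then show ?thesis
    unfolding affine_forms_def by (subst card_image[OF inj_affine_form])
qed

lemma card_bit_vec: "CARD(bit ^ 'm::finite) = 2 ^ CARD('m)"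
  by simp

lemma affine_forms_add:
  assumes "l \<in> affine_forms" "l' \<in> affine_forms"
  shows "(\<lambda>y. l y + l' y) \<in> affine_forms"
proof -
  obtain a b a' b' where "l = affine_form a b" "l' = affine_form a' b'"
    using assms by (auto simp: affine_forms_def)
  then have "(\<lambda>y. l y + l' y) = affine_form (a + a') (\<lambda>k. b k + b' k)"
    by (simp add: affine_form_def sum.distrib distrib_left ac_simps fun_eq_iff)
  then show ?thesis unfolding affine_forms_def by force
qed

lemma affine_forms_const: "(\<lambda>_. c) \<in> affine_forms"
proof -
  have "(\<lambda>_. c) = affine_form c (\<lambda>_. 0)" by (auto simp: affine_form_def)
  then show ?thesis unfolding affine_forms_def by (metis case_prod_conv rangeI)
qed

text \<open>A nonconstant form has some coefficient \<open>b k = 1\<close>. Translation by the k-th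
  unit vector is then an involution that flips the value of \<open>g\<close>, so it exchanges zeros
  and ones.\<close>

lemma card_zeros_affine_form:
  fixes g :: "bit ^ 'm::finite \<Rightarrow> bit"
  assumes "g \<in> affine_forms" "\<And>c. g \<noteq> (\<lambda>_. c)"
  shows "2 * card {y. g y = 0} = 2 ^ CARD('m)" "2 * card {y. g y = 1} = 2 ^ CARD('m)"
proof -
  obtain a b where g: "g = affine_form a b" using assms by (auto simp: affine_forms_def)
  have "\<exists>k. b k = 1"
  proof (rule ccontr)
    assume "\<nexists>k. b k = 1"
    then have "g = (\<lambda>_. a)" by (auto simp: g affine_form_def)
    then show False using assms by blast
  qed
  then obtain k where k: "b k = 1" ..
  define flip :: "bit ^ 'm \<Rightarrow> bit ^ 'm" where "flip y = y + axis k 1" for y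
  have flip: "g (flip y) = g y + 1" for y
  proof -
    have "g (flip y) = g y + (\<Sum>i\<in>UNIV. b i * axis k 1 $ i)"
      by (simp add: g flip_def affine_form_def distrib_left sum.distrib ac_simps)
    also have "(\<Sum>i\<in>UNIV. b i * axis k 1 $ i) = 1"
      using k by (simp add: axis_def if_distrib cong: if_cong)
    finally show ?thesis .
  qed
  have "flip (flip y) = y" for y
    by (simp add: flip_def vec_eq_iff add.assoc bit_add_self)
  then have "bij_betw flip {y. g y = 0} {y. g y = 1}"
    by (intro bij_betwI[where g = flip]) (auto simp: flip)
  then have eq: "card {y. g y = 0} = card {y. g y = 1}" by (rule bij_betw_same_card)
  have "card ({y. g y = 0} \<union> {y. g y = 1}) = card {y. g y = 0} + card {y. g y = 1}"
    by (rule card_Un_disjoint) auto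
  also have "{y. g y = 0} \<union> {y. g y = 1} = UNIV" by auto
  finally have "card {y. g y = 0} + card {y. g y = 1} = 2 ^ CARD('m)"
    by (simp only: card_bit_vec)
  with eq show "2 * card {y. g y = 0} = 2 ^ CARD('m)" "2 * card {y. g y = 1} = 2 ^ CARD('m)"
    by simp_all
qed


section \<open>Affine forms vanishing on the samples\<close>

text \<open>The group W of the outline: differences of forms that label the sample points
  alike.\<close>

definition vanishing :: "(bit ^ 'm::finite) list \<Rightarrow> (bit ^ 'm \<Rightarrow> bit) set" where
  "vanishing ys = {g \<in> affine_forms. \<forall>y\<in>set ys. g y = 0}"

lemma vanishing_zero: "(\<lambda>_. 0) \<in> vanishing ys"
  by (simp add: vanishing_def affine_forms_const)

lemma vanishing_add:
  "g \<in> vanishing ys \<Longrightarrow> h \<in> vanishing ys \<Longrightarrow> (\<lambda>y. g y + h y) \<in> vanishing ys"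
  by (auto simp: vanishing_def affine_forms_add)

text \<open>Pigeonhole: with m = \<open>CARD('m)\<close>, there are \<open>2 ^ (m + 1)\<close> forms
  but only \<open>2 ^ m\<close> label lists on m points, so two forms agree on the points. Their sum
  is a nonzero vanishing form.\<close>

lemma two_le_card_vanishing:
  fixes ys :: "(bit ^ 'm::finite) list"
  assumes "length ys = CARD('m)"
  shows "2 \<le> card (vanishing ys)"
proof -
  have "\<not> inj_on (\<lambda>l. map l ys) affine_forms"
  proof
    assume "inj_on (\<lambda>l. map l ys) affine_forms"
    then have "card (affine_forms :: (bit ^ 'm \<Rightarrow> bit) set) \<le> card {zs :: bit list. length zs = CARD('m)}"
      by (rule card_inj_on_le) (auto simp: assms finite_lists_length)
    also have "\<dots> = 2 ^ CARD('m)"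
      using card_lists_length_eq[of "UNIV :: bit set" "CARD('m)"] by simp
    finally show False by (simp add: card_affine_forms)
  qed
  then obtain l l' where l: "l \<in> affine_forms" "l' \<in> affine_forms" "map l ys = map l' ys" "l \<noteq> l'"
    by (auto simp: inj_on_def)
  define g where "g = (\<lambda>y. l y + l' y)"
  have "g \<in> vanishing ys" using l by (auto simp: g_def vanishing_def affine_forms_add bit_add_eq_0_iff)
  moreover have "g \<noteq> (\<lambda>_. 0)" using l(4) by (auto simp: g_def fun_eq_iff bit_add_eq_0_iff)
  ultimately have "card {\<lambda>_. 0, g} \<le> card (vanishing ys)"
    by (intro card_mono) (auto simp: vanishing_zero)
  then show ?thesis using \<open>g \<noteq> (\<lambda>_. 0)\<close> by (simp split: if_splits)
qed

text \<open>A third element brings a fourth: two distinct nonzero forms have a sum that differs from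
  both of them and from zero.\<close>

lemma four_le_card_vanishing:
  fixes ys :: "(bit ^ 'm::finite) list"
  assumes "length ys = CARD('m)" "card (vanishing ys) \<noteq> 2"
  shows "4 \<le> card (vanishing ys)"
proof -
  have "3 \<le> card (vanishing ys)" using assms two_le_card_vanishing[of ys] by linarith
  then obtain T where T: "T \<subseteq> vanishing ys" "card T = 3"
    by (meson obtain_subset_with_card_n)
  have "2 \<le> card (T - {\<lambda>_. 0})" using T by (simp add: card_Diff_singleton_if)
  then obtain T' where T': "T' \<subseteq> T - {\<lambda>_. 0}" "card T' = 2"
    by (meson obtain_subset_with_card_n)
  then obtain g h where gh: "T' = {g, h}" "g \<noteq> h" by (auto simp: card_2_iff)
  define k where "k = (\<lambda>y. g y + h y)"
  have "g \<in> vanishing ys" "h \<in> vanishing ys" "g \<noteq> (\<lambda>_. 0)" "h \<noteq> (\<lambda>_. 0)" using T T' gh by auto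
  moreover have "k \<noteq> (\<lambda>_. 0)" using gh unfolding k_def fun_eq_iff bit_add_eq_0_iff by blast
  moreover have "k \<noteq> g" "k \<noteq> h" using calculation(3,4) by (simp_all add: k_def fun_eq_iff)
  moreover have "k \<in> vanishing ys" using calculation by (auto simp: k_def vanishing_add)
  ultimately have "card {\<lambda>_. 0, g, h, k} \<le> card (vanishing ys)"
    by (intro card_mono) (auto simp: vanishing_zero)
  moreover have "card {\<lambda>_. 0, g, h, k} = 4"
  proof -
    have "b \<noteq> a \<Longrightarrow> c \<noteq> a \<Longrightarrow> d \<noteq> a \<Longrightarrow> b \<noteq> c \<Longrightarrow> d \<noteq> b \<Longrightarrow> d \<noteq> c \<Longrightarrow> card {a, b, c, d} = 4"
      for a b c d :: "bit ^ 'm \<Rightarrow> bit" by auto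
    then show ?thesis
      using gh(2) \<open>g \<noteq> (\<lambda>_. 0)\<close> \<open>h \<noteq> (\<lambda>_. 0)\<close> \<open>k \<noteq> (\<lambda>_. 0)\<close> \<open>k \<noteq> g\<close> \<open>k \<noteq> h\<close> by blast
  qed
  ultimately show ?thesis by simp
qed

text \<open>Double counting of pairs of a sample list and a form vanishing on it. The zero form
  vanishes on all \<open>N ^ n\<close> lists, the constant 1 on none, and each of the other
  \<open>2 * N - 2\<close> forms on \<open>M = N ^ (n - 1)\<close> of them; the total is
  \<open>3 * N ^ n - 2 * M\<close>.\<close>

lemma sum_card_vanishing_less:
  defines "n \<equiv> CARD('m::finite)"
  shows "(\<Sum>ys | length ys = n. card (vanishing (ys :: (bit ^ 'm) list)))
    < 3 * card {ys :: (bit ^ 'm) list. length ys = n}"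
proof -
  let ?Y = "{ys :: (bit ^ 'm) list. length ys = n}"
  let ?L = "affine_forms :: (bit ^ 'm \<Rightarrow> bit) set"
  define N :: nat where "N = 2 ^ n"
  define M where "M = N ^ (n - 1)"
  have n: "n > 0" and N: "N \<ge> 1" by (simp_all add: n_def N_def)
  then have M: "N ^ n = N * M" "M > 0" by (simp_all add: M_def flip: power_Suc)
  have cardY: "card ?Y = N ^ n"
    using card_lists_length_eq[of "UNIV :: (bit ^ 'm) set" n]
    unfolding N_def n_def card_bit_vec by simp
  define num where "num g = card {ys \<in> ?Y. \<forall>y\<in>set ys. g y = 0}" for g :: "bit ^ 'm \<Rightarrow> bit"
  have num: "num g = card {y. g y = 0} ^ n" for g
    unfolding num_def using card_lists_length_eq[of "{y. g y = 0}" n]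
    by (simp add: subset_eq conj_commute)
  have num_nonconst: "num g = M" if "g \<in> ?L - {\<lambda>_. 0, \<lambda>_. 1}" for g
  proof -
    have "g \<noteq> (\<lambda>_. c)" for c using that by (cases c) auto
    then have "2 * card {y. g y = 0} = 2 ^ n"
      using that card_zeros_affine_form[of g] by (simp add: n_def)
    \<comment> \<open>\<open>N = 2 ^ n\<close> is both the number of points and the product of the n
      factors 2 lost by halving the choice of every sample.\<close>
    then have "N * num g = N ^ n"
      unfolding num N_def power_mult_distrib[symmetric] by simp
    with M(1) N show ?thesis by simp
  qed
  have "(\<Sum>ys\<in>?Y. card (vanishing ys)) = (\<Sum>ys\<in>?Y. \<Sum>g\<in>?L. of_bool (\<forall>y\<in>set ys. g y = 0))"
    by (simp add: vanishing_def Int_def)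
  also have "\<dots> = (\<Sum>g\<in>?L. num g)"
    by (subst sum.swap) (simp add: num_def finite_lists_length Int_def)
  also have "\<dots> = (\<Sum>g\<in>?L - {\<lambda>_. 0, \<lambda>_. 1}. num g) + (\<Sum>g\<in>{\<lambda>_. 0, \<lambda>_. 1}. num g)"
    by (rule sum.subset_diff) (simp_all add: affine_forms_const)
  also have "(\<Sum>g\<in>?L - {\<lambda>_. 0, \<lambda>_. 1}. num g) = card (?L - {\<lambda>_. 0, \<lambda>_. 1}) * M"
    using num_nonconst by simp
  also have "card (?L - {\<lambda>_. 0, \<lambda>_. 1}) = 2 * N - 2"
    by (subst card_Diff_subset)
      (simp_all add: affine_forms_const card_affine_forms fun_eq_iff flip: N_def n_def)
  \<comment> \<open>The constant 1 contributes \<open>0 ^ n\<close>, which is 0 because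
    \<open>n > 0\<close>.\<close>
  also have "(\<Sum>g\<in>{\<lambda>_. 0, \<lambda>_. 1 :: bit}. num g) = N ^ n"
    using n card_bit_vec[where 'm = 'm] by (simp add: num fun_eq_iff N_def flip: n_def)
  also have "(2 * N - 2) * M + N ^ n < 3 * N ^ n"
  proof -
    have "(2 * N - 2) * M = 2 * (N * M) - 2 * M" by (simp add: diff_mult_distrib)
    moreover have "M \<le> N * M" using N by simp
    ultimately show ?thesis using M by linarith
  qed
  finally show ?thesis by (simp add: cardY)
qed

text \<open>If lists outside \<open>?G\<close> were at least half, their weight 4 against the weight
  2 of \<open>?G\<close> would push the average of \<open>card (vanishing ys)\<close> to 3 or
  more.\<close>

lemma card_vanishing_eq_2_majority:
  defines "n \<equiv> CARD('m::finite)"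
  shows "card {ys :: (bit ^ 'm) list. length ys = n}
    < 2 * card {ys :: (bit ^ 'm) list. length ys = n \<and> card (vanishing ys) = 2}"
proof -
  let ?Y = "{ys :: (bit ^ 'm) list. length ys = n}"
  let ?G = "{ys :: (bit ^ 'm) list. length ys = n \<and> card (vanishing ys) = 2}"
  have fin: "finite ?Y" by (rule finite_lists_length)
  have G: "?G \<subseteq> ?Y" by auto
  have "4 * card (?Y - ?G) + 2 * card ?G = (\<Sum>ys\<in>?Y - ?G. 4) + (\<Sum>ys\<in>?G. 2)"
    by simp
  also have "\<dots> \<le> (\<Sum>ys\<in>?Y - ?G. card (vanishing ys)) + (\<Sum>ys\<in>?G. card (vanishing ys))"
    by (intro add_mono sum_mono) (auto simp: n_def intro: four_le_card_vanishing)
  also have "\<dots> = (\<Sum>ys\<in>?Y. card (vanishing ys))"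
    by (rule sum.subset_diff[OF G fin, symmetric])
  finally have "4 * card (?Y - ?G) + 2 * card ?G < 3 * card ?Y"
    using sum_card_vanishing_less[where 'm = 'm] unfolding n_def by (rule le_less_trans)
  moreover have "card (?Y - ?G) + card ?G = card ?Y"
    using card_Diff_subset[OF finite_subset[OF G fin] G] card_mono[OF fin G] by simp
  ultimately show ?thesis by linarith
qed


section \<open>The posterior\<close>

definition labelled :: "('a \<Rightarrow> 'b) \<Rightarrow> 'a list \<Rightarrow> ('a \<times> 'b) list" where
  "labelled l ys = map (\<lambda>y. (y, l y)) ys"

definition consistent :: "((bit ^ 'm::finite) \<times> bit) list \<Rightarrow> (bit ^ 'm \<Rightarrow> bit) set" where
  "consistent s = {l \<in> affine_forms. \<forall>(y, z)\<in>set s. l y = z}"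

text \<open>The version space is a coset of \<open>vanishing ys\<close>; in characteristic 2 adding
  \<open>l\<close> is its own inverse.\<close>

lemma consistent_labelled:
  assumes "l \<in> affine_forms"
  shows "consistent (labelled l ys) = (\<lambda>g y. l y + g y) ` vanishing ys"
proof (intro equalityI subsetI)
  fix h assume "h \<in> consistent (labelled l ys)"
  then have "(\<lambda>y. l y + h y) \<in> vanishing ys"
    using assms by (auto simp: consistent_def labelled_def vanishing_def affine_forms_add bit_add_self)
  moreover have "h = (\<lambda>y. l y + (l y + h y))"
    by (simp add: bit_add_self flip: add.assoc)
  ultimately show "h \<in> (\<lambda>g y. l y + g y) ` vanishing ys" by (intro rev_image_eqI)
next
  fix h assume "h \<in> (\<lambda>g y. l y + g y) ` vanishing ys"
  then show "h \<in> consistent (labelled l ys)"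
    using assms by (auto simp: consistent_def labelled_def vanishing_def affine_forms_add)
qed

lemma LC_eq:
  "(LC :: ((bit ^ 'm::finite) \<times> bit) pmf pmf) = map_pmf graph_hyp (pmf_of_set affine_forms)"
proof -
  have "Pi_pmf UNIV 0 (\<lambda>_. pmf_of_set UNIV) = pmf_of_set (UNIV :: ('m \<Rightarrow> bit) set)"
    by (subst Pi_pmf_of_set) (auto simp: PiE_dflt_def)
  then have "pair_pmf (pmf_of_set (UNIV :: bit set)) (Pi_pmf UNIV 0 (\<lambda>_. pmf_of_set UNIV)) =
      pmf_of_set (UNIV :: (bit \<times> ('m \<Rightarrow> bit)) set)"
    by (simp add: pair_pmf_of_set)
  then have "map_pmf (\<lambda>(a, b). affine_form a b)
      (pair_pmf (pmf_of_set UNIV) (Pi_pmf UNIV 0 (\<lambda>_. pmf_of_set UNIV))) =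
      pmf_of_set (affine_forms :: (bit ^ 'm \<Rightarrow> bit) set)"
    unfolding affine_forms_def using inj_affine_form[where 'm = 'm]
    by (simp add: map_pmf_of_set_inj)
  from this[symmetric] show ?thesis
    unfolding LC_def by (simp add: case_prod_unfold map_pmf_comp)
qed

lemma graph_hyp_eq:
  "graph_hyp l = map_pmf (\<lambda>y. (y, l y)) (pmf_of_set (UNIV :: (bit ^ 'm::finite) set))"
proof -
  have "{(y, l y) | y. True} = range (\<lambda>y. (y, l y))" by auto
  then show ?thesis
    unfolding graph_hyp_def by (simp add: map_pmf_of_set_inj inj_on_def)
qed

lemma expectation_graph_hyp:
  fixes l :: "bit ^ 'm::finite \<Rightarrow> bit"
    and f :: "(bit ^ 'm) \<times> bit \<Rightarrow> real"
  shows "measure_pmf.expectation (graph_hyp l) f = (\<Sum>y\<in>UNIV. f (y, l y)) / 2 ^ CARD('m)"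
  by (simp add: graph_hyp_eq integral_pmf_of_set)

text \<open>The sample points are independent of the form, so all randomness sits in one uniform
  pair, and probabilities become ratios of cardinalities.\<close>

lemma hyp_samples_LC:
  "hyp_samples LC n = map_pmf (\<lambda>(l, ys). (graph_hyp l, labelled l ys))
     (pmf_of_set (affine_forms \<times> {ys :: (bit ^ 'm::finite) list. length ys = n}))"
proof -
  have "hyp_samples LC n = map_pmf (\<lambda>(l, ys). (graph_hyp l, labelled l ys))
      (pair_pmf (pmf_of_set affine_forms) (replicate_pmf n (pmf_of_set (UNIV :: (bit ^ 'm) set))))"
    unfolding hyp_samples_def LC_eq graph_hyp_eq pair_pmf_def labelled_def
    by (simp add: bind_map_pmf replicate_pmf_map_pmf map_pmf_comp map_bind_pmf flip: map_pmf_def)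
  then show ?thesis
    using affine_forms_const[of 0] lists_length_nonempty[of n]
    by (subst (asm) replicate_pmf_of_set_UNIV, subst (asm) pair_pmf_of_set)
      (auto simp only: finite_lists_length finite)
qed

text \<open>Conditioning a uniform pair \<open>(l, ys)\<close> on \<open>labelled l ys = s\<close>
  forces \<open>ys = map fst s\<close>, which leaves exactly one pair per consistent form.\<close>

lemma posterior_LC:
  fixes s :: "((bit ^ 'm::finite) \<times> bit) list"
  assumes "consistent s \<noteq> {}"
  shows "posterior LC s = map_pmf graph_hyp (pmf_of_set (consistent s))"
proof -
  let ?D = "affine_forms \<times> {ys :: (bit ^ 'm) list. length ys = length s}"
  let ?f = "\<lambda>(l, ys). (graph_hyp l, labelled l ys)"
  let ?S = "?f -` {(p, s'). s' = s}"
  have inter: "?D \<inter> ?S = (\<lambda>l. (l, map fst s)) ` consistent s"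
    by (force simp: labelled_def consistent_def comp_def image_iff intro!: map_idI)
  have ne: "?D \<inter> ?S \<noteq> {}" unfolding inter using assms by simp
  have fin: "finite ?D" by (intro finite_cartesian_product finite finite_lists_length)
  have D: "set_pmf (pmf_of_set ?D) = ?D" 
    using affine_forms_const[of 0] lists_length_nonempty[of "length s"]
    by (intro set_pmf_of_set[OF _ fin]) blast
  have "posterior LC s = map_pmf fst (map_pmf ?f (cond_pmf (pmf_of_set ?D) ?S))"
    unfolding posterior_def hyp_samples_LC 
    by (subst cond_map_pmf) (unfold D, rule ne, rule refl)
  also have "cond_pmf (pmf_of_set ?D) ?S = pmf_of_set ((\<lambda>l. (l, map fst s)) ` consistent s)"
    using cond_pmf_of_set[OF fin ne] by (simp only: inter)
  also have "\<dots> = map_pmf (\<lambda>l. (l, map fst s)) (pmf_of_set (consistent s))"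
    using assms by (intro map_pmf_of_set_inj[symmetric]) (auto simp: inj_on_def)
  finally show ?thesis by (simp add: map_pmf_comp)
qed

definition mean_over :: "(bit ^ 'm::finite \<Rightarrow> bit) set \<Rightarrow> ((bit ^ 'm) \<times> bit) query \<Rightarrow> real" where
  "mean_over V f = (\<Sum>l\<in>V. measure_pmf.expectation (graph_hyp l) f) / card V"

lemma posterior_mean_curator_LC:
  assumes "consistent s \<noteq> {}"
  shows "posterior_mean_curator LC s h f = return_pmf (mean_over (consistent s) f)"
  using assms by (simp add: posterior_mean_curator_def posterior_LC integral_pmf_of_set mean_over_def)


section \<open>The attack\<close>

text \<open>Induction on \<open>S\<close>. If \<open>d x \<noteq> 0\<close>, only one value of the
  new weight at \<open>x\<close> makes the sum for \<open>d\<close> vanish; if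
  \<open>d x = 0\<close>, the old weights already decide. Finitely many values are excluded from an
  infinite interval.\<close>

lemma separating_weights_on:
  fixes D :: "('a \<Rightarrow> real) set"
  assumes "finite D" "finite S"
  shows "\<exists>w. (\<forall>y. 0 \<le> w y \<and> w y \<le> 1) \<and>
    (\<forall>d\<in>D. (\<exists>y\<in>S. d y \<noteq> 0) \<longrightarrow> (\<Sum>y\<in>S. w y * d y) \<noteq> 0)"
  using assms(2)
proof (induction S)
  case empty
  show ?case by (rule exI[of _ "\<lambda>_. 0"]) simp
next
  case (insert x S)
  then obtain w where w: "\<forall>y. 0 \<le> w y \<and> w y \<le> 1"
    and sep: "\<forall>d\<in>D. (\<exists>y\<in>S. d y \<noteq> 0) \<longrightarrow> (\<Sum>y\<in>S. w y * d y) \<noteq> 0" by blast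
  \<comment> \<open>A \<open>d\<close> with \<open>d x = 0\<close> merely excludes the value 0,
    since division by zero yields 0.\<close>
  have "infinite ({0..1} - (\<lambda>d. - (\<Sum>y\<in>S. w y * d y) / d x) ` D)"
    using assms(1) by (intro Diff_infinite_finite) (simp_all add: infinite_Icc)
  then obtain t where t: "t \<in> {0..1}" "t \<notin> (\<lambda>d. - (\<Sum>y\<in>S. w y * d y) / d x) ` D"
    using infinite_imp_nonempty by blast
  have "(\<Sum>y\<in>insert x S. (w(x := t)) y * d y) \<noteq> 0" if d: "d \<in> D" "\<exists>y\<in>insert x S. d y \<noteq> 0" for d
  proof -
    have eq: "(\<Sum>y\<in>insert x S. (w(x := t)) y * d y) = t * d x + (\<Sum>y\<in>S. w y * d y)"
      using insert.hyps by (simp, intro sum.cong) auto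
    show ?thesis
    proof (cases "d x = 0")
      case True
      then show ?thesis using d sep eq by auto
    next
      case False
      have "t \<noteq> - (\<Sum>y\<in>S. w y * d y) / d x" using t(2) d(1) by blast
      then show ?thesis using False unfolding eq by (auto simp: field_simps add_eq_0_iff)
    qed
  qed
  then show ?case using w t(1) by (intro exI[of _ "w(x := t)"]) auto
qed

text \<open>Injectivity of a linear functional on \<open>C\<close> means that it is nonzero on
  differences of distinct members.\<close>

lemma separating_weights:
  fixes C :: "('a::finite \<Rightarrow> real) set"
  assumes "finite C"
  shows "\<exists>w. (\<forall>y. 0 \<le> w y \<and> w y \<le> 1) \<and> inj_on (\<lambda>c. \<Sum>y\<in>UNIV. w y * c y) C"
proof -
  have "finite ((\<lambda>(c, c') y. c y - c' y) ` (C \<times> C))" using assms by simp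
  from separating_weights_on[OF this finite] obtain w where
    w: "\<forall>y. 0 \<le> w y \<and> w y \<le> 1"
    and sep: "\<forall>d\<in>(\<lambda>(c, c') y. c y - c' y) ` (C \<times> C).
      (\<exists>y\<in>UNIV. d y \<noteq> 0) \<longrightarrow> (\<Sum>y\<in>UNIV. w y * d y) \<noteq> 0"
    by blast
  have "inj_on (\<lambda>c. \<Sum>y\<in>UNIV. w y * c y) C"
  proof (rule inj_onI, rule ccontr)
    fix c c' assume c: "c \<in> C" "c' \<in> C" "c \<noteq> c'"
      and eq: "(\<Sum>y\<in>UNIV. w y * c y) = (\<Sum>y\<in>UNIV. w y * c' y)"
    have "(\<lambda>y. c y - c' y) \<in> (\<lambda>(c, c') y. c y - c' y) ` (C \<times> C)" using c by auto
    from bspec[OF sep this] have "(\<Sum>y\<in>UNIV. w y * (c y - c' y)) \<noteq> 0" using c(3) by auto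
    with eq show False by (simp add: right_diff_distrib sum_subtractf)
  qed
  with w show ?thesis by blast
qed

section \<open>Recovering the version space from one answer\<close>

text \<open>The posterior predictive probability of label 1 at \<open>y\<close>, when the posterior
  is uniform on \<open>V\<close>.\<close>

definition label_mean :: "(bit ^ 'm::finite \<Rightarrow> bit) set \<Rightarrow> bit ^ 'm \<Rightarrow> real" where
  "label_mean V y = (\<Sum>l\<in>V. of_bool (l y = 1)) / card V"

text \<open>Zero on points labelled 0, so that its mean over \<open>V\<close> is a linear functional
  of \<open>label_mean V\<close>.\<close>

definition weight_query :: "(bit ^ 'm::finite \<Rightarrow> real) \<Rightarrow> ((bit ^ 'm) \<times> bit) query" where
  "weight_query w = (\<lambda>(y, z). w y * of_bool (z = 1))"

lemma mean_over_weight_query: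
  "mean_over V (weight_query w) =
    (\<Sum>y\<in>UNIV. w y * label_mean V y) / 2 ^ CARD('m)" for V :: "(bit ^ 'm::finite \<Rightarrow> bit) set"
proof -
  have "mean_over V (weight_query w) =
      (\<Sum>l\<in>V. \<Sum>y\<in>UNIV. w y * of_bool (l y = 1)) / 2 ^ CARD('m) / card V"
    by (simp add: mean_over_def weight_query_def expectation_graph_hyp sum_divide_distrib)
  also have "(\<Sum>l\<in>V. \<Sum>y\<in>UNIV. w y * of_bool (l y = 1)) = (\<Sum>y\<in>UNIV. w y * (\<Sum>l\<in>V. of_bool (l y = 1)))"
    by (subst sum.swap) (simp only: sum_distrib_left)
  finally show ?thesis
    by (simp add: label_mean_def sum_divide_distrib mult.commute)
qed

lemma label_mean_eq_of_bool_iff: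
  assumes "V \<noteq> {}"
  shows "label_mean V y = of_bool (z = 1) \<longleftrightarrow> (\<forall>l\<in>V. l y = z)"
proof -
  have fin: "finite V" by simp
  then have "card V \<noteq> 0" using assms by simp
  then have "label_mean V y = of_bool (z = 1) \<longleftrightarrow>
      card {l \<in> V. l y = 1} = (if z = 1 then card V else 0)"
    using fin by (cases z) (auto simp: label_mean_def Int_def)
  also have "\<dots> \<longleftrightarrow> {l \<in> V. l y = 1} = (if z = 1 then V else {})"
    using fin card_subset_eq[of V "{l \<in> V. l y = 1}"] by auto
  also have "\<dots> \<longleftrightarrow> (\<forall>l\<in>V. l y = z)"
    by (cases z) auto
  finally show ?thesis .
qed

text \<open>Version spaces are cut out by label constraints. A constraint \<open>(y, z)\<close> of
  one makes its label mean at \<open>y\<close> extreme (0 or 1); equality of means forces all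
  members of the other to satisfy it. Arbitrary sets of forms can share means: all forms and the two
  constants both give 1/2 everywhere.\<close>

lemma consistent_eq_of_label_mean_eq:
  assumes "consistent s \<noteq> {}" "consistent s' \<noteq> {}"
    and eq: "label_mean (consistent s) = label_mean (consistent s')"
  shows "consistent s = consistent s'"
proof -
  have "consistent t \<subseteq> consistent t'"
    if "consistent t \<noteq> {}" "consistent t' \<noteq> {}" "label_mean (consistent t) = label_mean (consistent t')"
    for t t' :: "((bit ^ 'a) \<times> bit) list"
  proof -
    have "\<forall>l\<in>consistent t. l y = z" if "(y, z) \<in> set t'" for y z
    proof -
      have "\<forall>l\<in>consistent t'. l y = z" using that by (auto simp: consistent_def)
      then show ?thesis
        using label_mean_eq_of_bool_iff \<open>consistent t \<noteq> {}\<close> \<open>consistent t' \<noteq> {}\<close>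
          \<open>label_mean (consistent t) = label_mean (consistent t')\<close> by metis
    qed
    then show ?thesis by (auto simp: consistent_def)
  qed
  from this[of s s'] this[of s' s] show ?thesis using assms by auto
qed

section \<open>The inaccurately answered query\<close>

text \<open>The analyst cannot tell which member of \<open>V\<close> is true, so \<open>SOME\<close>
  fixes a reference form. The query is the indicator of those points of its graph at which some
  member of \<open>V\<close> disagrees.\<close>

definition attack_query :: "(bit ^ 'm::finite \<Rightarrow> bit) set \<Rightarrow> ((bit ^ 'm) \<times> bit) query" where
  "attack_query V = (\<lambda>(y, z). of_bool (z = (SOME l. l \<in> V) y \<and> (\<exists>l\<in>V. l y \<noteq> z)))"

lemma attack_query_inaccurate:
  fixes l :: "bit ^ 'm::finite \<Rightarrow> bit"
  assumes "card (vanishing ys) = 2" "ys \<noteq> []" "l \<in> affine_forms"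
  defines "V \<equiv> consistent (labelled l ys)"
  shows "\<not> accurate (1 / 4) (graph_hyp l) (attack_query V) (mean_over V (attack_query V))"
proof -
  obtain a b where ab: "vanishing ys = {a, b}" "a \<noteq> b" using assms(1) by (auto simp: card_2_iff)
  define g where "g = (if a = (\<lambda>_. 0) then b else a)"
  have g: "vanishing ys = {\<lambda>_. 0, g}" "g \<noteq> (\<lambda>_. 0)"
    using ab vanishing_zero[of ys] unfolding g_def by (auto split: if_splits)
  have "g \<in> vanishing ys" using g by simp
  then have "g \<in> affine_forms" "g (hd ys) = 0" using assms(2) by (simp_all add: vanishing_def)
  \<comment> \<open>The zero of \<open>g\<close> at a sample point rules out the constant 1, so the
    two candidates differ on exactly half of the points.\<close>
  moreover have "g \<noteq> (\<lambda>_. c)" for c using g(2) \<open>g (hd ys) = 0\<close> by (cases c) auto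
  ultimately have half: "2 * card {y. g y = 1} = 2 ^ CARD('m)"
    by (intro card_zeros_affine_form)
  define l' where "l' = (\<lambda>y. l y + g y)"
  have V: "V = {l, l'}" using assms(3) by (simp add: V_def consistent_labelled g l'_def)
  have diff: "l y \<noteq> l' y \<longleftrightarrow> g y = 1" for y
    by (cases "g y"; cases "l y") (simp_all add: l'_def)
  have ne: "l \<noteq> l'" using g diff by (auto simp: fun_eq_iff)
  \<comment> \<open>Here \<open>l0\<close> is the form picked by \<open>SOME\<close>, which may be
    the true form \<open>l\<close> or the other one \<open>l'\<close>; each case below is an
    instance.\<close>
  have V2: "measure_pmf.expectation (graph_hyp l0) (attack_query V) = 1 / 2 \<and>
      measure_pmf.expectation (graph_hyp l1) (attack_query V) = 0"
    if V': "V = {l0, l1}" and diff: "\<And>y. l0 y \<noteq> l1 y \<longleftrightarrow> g y = 1"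
      and l0: "l0 = (SOME l. l \<in> V)" for l0 l1
  proof -
    have aq: "attack_query V (y, z) = of_bool (z = l0 y \<and> l0 y \<noteq> l1 y)" for y z
      unfolding attack_query_def prod.case l0[symmetric] unfolding V' by auto
    have "attack_query V (y, l0 y) = of_bool (g y = 1)" for y
      unfolding aq by (simp only: diff simp_thms)
    moreover have "attack_query V (y, l1 y) = 0" for y
      unfolding aq by auto
    moreover have "(\<Sum>y\<in>UNIV. of_bool (g y = 1)) = (2 ^ CARD('m) / 2 :: real)"
      using arg_cong[OF half, of real] by simp
    ultimately show ?thesis by (simp only: expectation_graph_hyp) simp
  qed
  have mean: "mean_over V f =
      (measure_pmf.expectation (graph_hyp l) f + measure_pmf.expectation (graph_hyp l') f) / 2" for f
    using ne by (simp add: mean_over_def V)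
  obtain e where e: "e = (SOME l. l \<in> V)" "e \<in> V"
    using some_in_eq[of V] V by blast
  from e(2) consider "e = l" | "e = l'" unfolding V by blast
  then show ?thesis
  proof cases
    case 1
    \<comment> \<open>The error is exactly 1/4, and \<open>accurate\<close> demands a strict
      inequality.\<close>
    from V2[OF V diff e(1)[unfolded this]] show ?thesis unfolding accurate_def mean by simp
  next
    case 2
    have V': "V = {l', l}" using V by (simp add: insert_commute)
    have diff': "l' y \<noteq> l y \<longleftrightarrow> g y = 1" for y using diff[of y] by metis
    from V2[OF V' diff' e(1)[unfolded 2]] show ?thesis unfolding accurate_def mean by simp
  qed
qed

section \<open>Transfer from samples to the game\<close>

text \<open>The coupling \<open>J\<close> keeps the samples, which \<open>game\<close> forgets, next
  to the transcript. Both laws are images of \<open>J\<close>, and on its support the event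
  \<open>G\<close> implies \<open>E\<close>.\<close>

lemma prob_game_ge:
  assumes "\<And>p s h. (p, s) \<in> G \<Longrightarrow> h \<in> set_pmf (transcript C A s k) \<Longrightarrow> (p, h) \<in> E"
  shows "measure_pmf.prob (hyp_samples P n) G \<le> measure_pmf.prob (game P n C A k) E"
proof -
  define J where "J = bind_pmf (hyp_samples P n)
    (\<lambda>x. map_pmf (\<lambda>h. (x, h)) (transcript C A (snd x) k))"
  have "game P n C A k = map_pmf (\<lambda>(x, h). (fst x, h)) J"
    by (simp add: J_def game_def map_bind_pmf map_pmf_comp case_prod_unfold)
  moreover have "hyp_samples P n = map_pmf fst J"
    by (simp add: J_def map_bind_pmf map_pmf_comp bind_return_pmf' map_pmf_const)
  moreover have "measure_pmf.prob J (fst -` G) \<le> measure_pmf.prob J ((\<lambda>(x, h). (fst x, h)) -` E)"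
    using assms by (intro measure_pmf.finite_measure_mono_AE) (auto simp: AE_measure_pmf_iff J_def)
  ultimately show ?thesis by simp
qed

lemma prob_card_vanishing_eq_2:
  defines "n \<equiv> CARD('m::finite)"
  shows "measure_pmf.prob (hyp_samples (LC :: ((bit ^ 'm) \<times> bit) pmf pmf) n)
      {(graph_hyp l, labelled l ys) | l ys.
        l \<in> affine_forms \<and> length ys = n \<and> card (vanishing ys) = 2} > 1 / 2"
    (is "measure_pmf.prob _ ?G > _")
proof -
  let ?L = "affine_forms :: (bit ^ 'm \<Rightarrow> bit) set" and ?Y = "{ys :: (bit ^ 'm) list. length ys = n}"
  let ?Y2 = "{ys :: (bit ^ 'm) list. length ys = n \<and> card (vanishing ys) = 2}"
  let ?f = "\<lambda>(l, ys). (graph_hyp l, labelled l ys)"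
  have fin: "finite (?L \<times> ?Y)" by (intro finite_cartesian_product finite finite_lists_length)
  have ne: "?L \<times> ?Y \<noteq> {}" using affine_forms_const[of 0] lists_length_nonempty[of n] by blast
  have "card (?L \<times> ?Y) < 2 * card (?L \<times> ?Y2)"
    using card_vanishing_eq_2_majority[where 'm = 'm]
    by (simp add: card_cartesian_product card_affine_forms n_def)
  also have "card (?L \<times> ?Y2) \<le> card ((?L \<times> ?Y) \<inter> ?f -` ?G)"
    using fin by (intro card_mono finite_Int) auto
  finally have "real (card (?L \<times> ?Y)) < 2 * real (card ((?L \<times> ?Y) \<inter> ?f -` ?G))" by linarith
  moreover have "card (?L \<times> ?Y) > 0" using fin ne by (simp only: card_gt_0_iff) blast
  ultimately show ?thesis
    unfolding hyp_samples_LC measure_map_pmf measure_pmf_of_set[OF ne fin]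
    by (simp add: field_simps)
qed

section \<open>The analyst and its transcripts\<close>

text \<open>Histories are oldest first, so \<open>a\<close> is the answer to the opening query
  \<open>q\<close>. All later moves repeat the same attack, which fills up any number of
  rounds.\<close>

definition decoding_analyst ::
    "((bit ^ 'm) \<times> bit) query \<Rightarrow> (real \<Rightarrow> (bit ^ 'm::finite \<Rightarrow> bit) set) \<Rightarrow> ((bit ^ 'm) \<times> bit) analyst" where
  "decoding_analyst q dec h = return_pmf
    (case h of [] \<Rightarrow> q | (_, a) # _ \<Rightarrow> attack_query (dec a))"

lemma set_transcript_Suc:
  "h \<in> set_pmf (transcript C A s (Suc k)) \<longleftrightarrow>
    (\<exists>h0 \<in> set_pmf (transcript C A s k). \<exists>f \<in> set_pmf (A h0). \<exists>a \<in> set_pmf (C s h0 f). h = h0 @ [(f, a)])"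
  by (auto simp: image_iff)

lemma transcript_decoding_analyst_first:
  fixes s :: "((bit ^ 'm::finite) \<times> bit) list"
  assumes "consistent s \<noteq> {}"
    and "h \<in> set_pmf (transcript (posterior_mean_curator LC) (decoding_analyst q dec) s (Suc k))"
  shows "\<exists>h'. h = (q, mean_over (consistent s) q) # h'"
  using assms(2)
proof (induction k arbitrary: h)
  case 0
  then show ?case by (simp add: decoding_analyst_def posterior_mean_curator_LC[OF assms(1)])
next
  case (Suc k)
  obtain h0 x where "h0 \<in> set_pmf (transcript (posterior_mean_curator LC) (decoding_analyst q dec) s (Suc k))"
    and h: "h = h0 @ [x]"
    using Suc.prems unfolding set_transcript_Suc[of _ _ _ _ "Suc k"] by blast
  from Suc.IH[OF this(1)] show ?case unfolding h by (metis append_Cons)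
qed

text \<open>With at least two rounds, the last query is asked on a history headed by the decoding
  answer, hence is the attack.\<close>

lemma transcript_decoding_analyst_attack:
  fixes s :: "((bit ^ 'm::finite) \<times> bit) list"
  assumes "consistent s \<noteq> {}" "dec (mean_over (consistent s) q) = consistent s"
    and "h \<in> set_pmf (transcript (posterior_mean_curator LC) (decoding_analyst q dec) s (Suc (Suc k)))"
  defines "f \<equiv> attack_query (consistent s)"
  shows "(f, mean_over (consistent s) f) \<in> set h"
proof -
  obtain h0 where h0: "h0 \<in> set_pmf (transcript (posterior_mean_curator LC) (decoding_analyst q dec) s (Suc k))"
    and h: "\<exists>f \<in> set_pmf (decoding_analyst q dec h0).
      \<exists>a \<in> set_pmf (posterior_mean_curator LC s h0 f). h = h0 @ [(f, a)]"
    using assms(3) unfolding set_transcript_Suc[of _ _ _ _ "Suc k"] by blast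
  obtain h' where "h0 = (q, mean_over (consistent s) q) # h'"
    using transcript_decoding_analyst_first[OF assms(1) h0] ..
  then show ?thesis
    using h assms(2) by (simp add: decoding_analyst_def posterior_mean_curator_LC[OF assms(1)] f_def)
qed

lemma valid_attack_query: "valid_query (attack_query V)"
  unfolding valid_query_def attack_query_def by (simp add: case_prod_unfold)

lemma valid_decoding_analyst:
  "valid_query q \<Longrightarrow> valid_analyst (decoding_analyst q dec)"
  unfolding valid_analyst_def decoding_analyst_def
  by (auto simp: valid_attack_query split: list.split)

text \<open>There are finitely many version spaces, so some weights separate their label means. The
  answer is then injective in the version space, and \<open>dec\<close> is an inverse of it.\<close>

lemma ex_decoding_query:
  "\<exists>q dec. valid_query q \<and>
    (\<forall>s :: ((bit ^ 'm::finite) \<times> bit) list. consistent s \<noteq> {} \<longrightarrow>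
      dec (mean_over (consistent s) q) = consistent s)"
proof -
  let ?V = "{V :: (bit ^ 'm \<Rightarrow> bit) set. V \<noteq> {} \<and> V \<in> range consistent}"
  obtain w where w: "\<forall>y. 0 \<le> w y \<and> w y \<le> 1"
    and inj: "inj_on (\<lambda>c. \<Sum>y\<in>UNIV. w y * c y) (label_mean ` ?V)"
    using separating_weights[of "label_mean ` ?V"] by auto
  have inj': "inj_on (\<lambda>V. mean_over V (weight_query w)) ?V"
  proof (rule inj_onI)
    fix V V' assume V: "V \<in> ?V" "V' \<in> ?V"
      and "mean_over V (weight_query w) = mean_over V' (weight_query w)"
    then have "label_mean V = label_mean V'"
      by (intro inj_onD[OF inj]) (auto simp: mean_over_weight_query)
    with V show "V = V'" using consistent_eq_of_label_mean_eq by auto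
  qed
  have "valid_query (weight_query w)" using w by (auto simp: valid_query_def weight_query_def)
  moreover have "inv_into ?V (\<lambda>V. mean_over V (weight_query w))
      (mean_over (consistent s) (weight_query w)) = consistent s"
    if "consistent s \<noteq> {}" for s
    using that by (intro inv_into_f_f[OF inj']) auto
  ultimately show ?thesis by blast
qed

theorem mainTheorem2:
  fixes n :: nat
  assumes "n \<ge> 1" and "CARD('n::finite) = n"
  shows "\<exists>A :: ((bit ^ 'n) \<times> bit) analyst. valid_analyst A \<and>
    measure_pmf.prob (game LC n (posterior_mean_curator LC) A (n + 2)) (some_inaccurate (1/4)) > 1/2"
proof -
  obtain q dec where q: "valid_query q" and dec: "\<And>s :: ((bit ^ 'n) \<times> bit) list.
      consistent s \<noteq> {} \<Longrightarrow> dec (mean_over (consistent s) q) = consistent s"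
    using ex_decoding_query[where 'm = 'n] by auto
  \<comment> \<open>The good event: the sample points are affinely independent, leaving two
    consistent forms.\<close>
  let ?G = "{(graph_hyp l, labelled l ys) | l ys :: (bit ^ 'n) list.
    l \<in> affine_forms \<and> length ys = n \<and> card (vanishing ys) = 2}"
  have "(p, h) \<in> some_inaccurate (1/4)"
    if "(p, s) \<in> ?G" and
      h: "h \<in> set_pmf (transcript (posterior_mean_curator LC) (decoding_analyst q dec) s (n + 2))"
    for p s h
  proof -
    obtain l ys where l: "p = graph_hyp l" "s = labelled l ys" "l \<in> affine_forms" "length ys = n"
        "card (vanishing ys) = 2"
      using \<open>(p, s) \<in> ?G\<close> by blast
    have ne: "consistent s \<noteq> {}" using l vanishing_zero[of ys] by (auto simp: consistent_labelled)
    have "ys \<noteq> []" using l assms(1) by auto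
    let ?f = "attack_query (consistent s)"
    from l \<open>ys \<noteq> []\<close> have "\<not> accurate (1/4) p ?f (mean_over (consistent s) ?f)"
      by (simp add: attack_query_inaccurate)
    \<comment> \<open>The number of rounds \<open>n + 2\<close> is \<open>Suc (Suc k)\<close> with
      \<open>k = n\<close>.\<close>
    moreover have "(?f, mean_over (consistent s) ?f) \<in> set h"
      using ne dec[OF ne] h by (intro transcript_decoding_analyst_attack) simp_all
    ultimately show ?thesis by (auto simp: some_inaccurate_def)
  qed
  then have "measure_pmf.prob (hyp_samples LC n) ?G \<le>
      measure_pmf.prob (game LC n (posterior_mean_curator LC) (decoding_analyst q dec) (n + 2))
        (some_inaccurate (1/4))"
    by (rule prob_game_ge)
  moreover have "measure_pmf.prob (hyp_samples LC n) ?G > 1/2"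
    using prob_card_vanishing_eq_2[where 'm = 'n] assms(2) by simp
  ultimately show ?thesis using valid_decoding_analyst[OF q, of dec] by (intro exI) auto
qed

end
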